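(* Let $f:\mathbb{R}^d\to\mathbb{R}\cup\{\infty\}$ be convex and $\ell$-smooth, attaining its minimum at $x^*\in\mathbb{R}^d$, and let $x^0\in\mathcal{X}$, $x^0\ne x^*$, $R:=\|x^0-x^*\|$. Suppose that $\psi:\mathbb{R}_+\to\mathbb{R}_+$, $\psi(x)=\frac{x^2}{2\ell(4x)}$, is strictly increasing and $\lim_{x\to\infty}\psi(x)=\infty$. Let $\Gamma_0>0$ satisfy $\Gamma_0\ge\frac{2(f(x^0)-f(x^* ))}{\|x^0-x^*\|^2}$ and let $\bar R\ge R$. Then Algorithm 2 run from $x^0$ with parameters $\Gamma_0$ and $\bar R$ guarantees that $$f(y^{k+1})-f(x^* )\le\Gamma_{k+1}R^2$$ for all integers $k\ge 0$.
   Context: $\|\cdot\|$ is the Euclidean norm for vectors and the spectral norm for matrices; $\mathbb{R}_+=[0,\infty)$. Setting: $f:\mathbb{R}^d\to\mathbb{R}\cup\{\infty\}$, $\mathcal{X}:=\{x\in\mathbb{R}^d: f(x)<\infty\}$ is assumed to be an open, $d$-dimensional (nonempty) convex set, and $\bar{\mathcal{X}}$ denotes its closure; $\mathrm{Proj}_{\bar{\mathcal{X}}}$ is the Euclidean projection onto $\bar{\mathcal{X}}$. $f$ is $\ell$-smooth if $f$ is twice differentiable on $\mathcal{X}$, continuous on $\bar{\mathcal{X}}$, and $\ell:[0,\infty)\to(0,\infty)$ is a non-decreasing, positive, locally Lipschitz function with $\|\nabla^2 f(x)\|\le \ell(\|\nabla f(x)\|)$ for all $x\in\mathcal{X}$.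 Algorithm 2 (input: $x^0\in\mathcal{X}$, $\ell$, $\Gamma_0$, $\bar R$; $\psi^{-1}$ is the inverse of $\psi$ on $\mathbb{R}_+$). Set $y^0=u^0=x^0$ and for $k=0,1,2,\dots$: $\gamma_k=1/\ell\left(4\psi^{-1}(\Gamma_k\bar R^2)\right)$; $\alpha_k=\sqrt{\gamma_k\Gamma_k}$; $y^{k+1}=\frac{1}{1+\alpha_k}y^k+\frac{\alpha_k}{1+\alpha_k}u^k-\frac{\gamma_k}{1+\alpha_k}\nabla f(y^k)$; $u^{k+1}=\mathrm{Proj}_{\bar{\mathcal{X}}}\left(u^k-\frac{\alpha_k}{\Gamma_k}\nabla f(y^{k+1})\right)$; $\Gamma_{k+1}=\Gamma_k/(1+\alpha_k)$. *)

theory Defs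
  imports "HOL-Analysis.Analysis"
begin

definition dom_ext :: "(real^'d \<Rightarrow> ereal) \<Rightarrow> (real^'d) set" where
  "dom_ext f = {x. f x < \<infinity>}"

text \<open>Since \<open>0 * \<infinity> = 0\<close> on \<open>ereal\<close>, the cases \<open>s = 0\<close> and \<open>t = 0\<close> are harmless.\<close>

definition convex_ext :: "(real^'d \<Rightarrow> ereal) \<Rightarrow> bool" where
  "convex_ext f \<longleftrightarrow>
     (\<forall>x y s t. 0 \<le> s \<longrightarrow> 0 \<le> t \<longrightarrow> s + t = 1 \<longrightarrow>
        f (s *\<^sub>R x + t *\<^sub>R y) \<le> ereal s * f x + ereal t * f y)"

text \<open>
  Meaningful only at points near which \<open>f\<close> is finite, since \<open>real_of_ereal\<close>
  sends \<open>\<infinity>\<close> to \<open>0\<close>; used below only on the open set \<open>dom_ext f\<close>.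
\<close>

definition grad :: "(real^'d \<Rightarrow> ereal) \<Rightarrow> real^'d \<Rightarrow> real^'d" where
  "grad f x = (THE g. GDERIV (\<lambda>z. real_of_ereal (f z)) x :> g)"

definition hess :: "(real^'d \<Rightarrow> ereal) \<Rightarrow> real^'d \<Rightarrow> real^'d^'d" where
  "hess f x = matrix (frechet_derivative (grad f) (at x))"

definition spectral_norm :: "real^'d^'d \<Rightarrow> real" where
  "spectral_norm A = onorm (\<lambda>v. A *v v)"

definition twice_differentiable :: "(real^'d \<Rightarrow> ereal) \<Rightarrow> (real^'d) set \<Rightarrow> bool" where
  "twice_differentiable f S \<longleftrightarrow>
     (\<forall>x\<in>S. (\<lambda>z. real_of_ereal (f z)) differentiable (at x) \<and> grad f differentiable (at x))"

definition locally_lipschitz_nonneg :: "(real \<Rightarrow> real) \<Rightarrow> bool" where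
  "locally_lipschitz_nonneg ell \<longleftrightarrow>
     (\<forall>s\<ge>0. \<exists>e>0. \<exists>L. L-lipschitz_on (cball s e \<inter> {0..}) ell)"

text \<open>
  Functions on \<open>[0, \<infinity>)\<close> are total functions on the reals whose values at negative
  arguments are irrelevant. Continuity on the closure of the domain is with respect to
  the topology of \<open>ereal\<close>: as the domain is open, \<open>f\<close> equals \<open>\<infinity>\<close> on its boundary,
  so \<open>f\<close> has to tend to \<open>\<infinity>\<close> there.
\<close>

definition ell_smooth :: "(real \<Rightarrow> real) \<Rightarrow> (real^'d \<Rightarrow> ereal) \<Rightarrow> bool" where
  "ell_smooth ell f \<longleftrightarrow>
     twice_differentiable f (dom_ext f) \<and>
     continuous_on (closure (dom_ext f)) f \<and>
     mono_on {0..} ell \<and> (\<forall>s\<ge>0. 0 < ell s) \<and> locally_lipschitz_nonneg ell \<and>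
     (\<forall>x\<in>dom_ext f. spectral_norm (hess f x) \<le> ell (norm (grad f x)))"

definition psi :: "(real \<Rightarrow> real) \<Rightarrow> real \<Rightarrow> real" where
  "psi ell x = x\<^sup>2 / (2 * ell (4 * x))"

definition psi_inv :: "(real \<Rightarrow> real) \<Rightarrow> real \<Rightarrow> real" where
  "psi_inv ell = the_inv_into {0..} (psi ell)"

text \<open>
  The sequences \<open>y\<close>, \<open>u\<close>, \<open>\<Gamma>\<close>, \<open>\<gamma>\<close>, \<open>\<alpha>\<close> are the iterates of the accelerated method; the
  equations determine them uniquely from the inputs (see \<open>accelerated_run_exists\<close>).
\<close>

definition accelerated_run ::
  "(real^'d \<Rightarrow> ereal) \<Rightarrow> (real \<Rightarrow> real) \<Rightarrow> real^'d \<Rightarrow> real \<Rightarrow> real \<Rightarrow>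
   (nat \<Rightarrow> real^'d) \<Rightarrow> (nat \<Rightarrow> real^'d) \<Rightarrow> (nat \<Rightarrow> real) \<Rightarrow> (nat \<Rightarrow> real) \<Rightarrow> (nat \<Rightarrow> real) \<Rightarrow> bool"
where
  "accelerated_run f ell x0 \<Gamma>0 Rbar y u \<Gamma> \<gamma> \<alpha> \<longleftrightarrow>
     y 0 = x0 \<and> u 0 = x0 \<and> \<Gamma> 0 = \<Gamma>0 \<and>
     (\<forall>k. \<gamma> k = 1 / ell (4 * psi_inv ell (\<Gamma> k * Rbar\<^sup>2)) \<and>
          \<alpha> k = sqrt (\<gamma> k * \<Gamma> k) \<and>
          y (Suc k) = (1 / (1 + \<alpha> k)) *\<^sub>R y k + (\<alpha> k / (1 + \<alpha> k)) *\<^sub>R u k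
                      - (\<gamma> k / (1 + \<alpha> k)) *\<^sub>R grad f (y k) \<and>
          u (Suc k) = closest_point (closure (dom_ext f))
                        (u k - (\<alpha> k / \<Gamma> k) *\<^sub>R grad f (y (Suc k))) \<and>
          \<Gamma> (Suc k) = \<Gamma> k / (1 + \<alpha> k))"

lemma accelerated_run_exists:
  fixes f :: "real^'d \<Rightarrow> ereal"
  shows "\<exists>y u \<Gamma> \<gamma> \<alpha>. accelerated_run f ell x0 \<Gamma>0 Rbar y u \<Gamma> \<gamma> \<alpha>"
proof -
  define gam where "gam G = 1 / ell (4 * psi_inv ell (G * Rbar\<^sup>2))" for G
  define alp where "alp G = sqrt (gam G * G)" for G
  define ynext where "ynext G y u = (1 / (1 + alp G)) *\<^sub>R y + (alp G / (1 + alp G)) *\<^sub>R u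
      - (gam G / (1 + alp G)) *\<^sub>R grad f y" for G y u
  define step where "step = (\<lambda>(y, u, G). (ynext G y u,
      closest_point (closure (dom_ext f)) (u - (alp G / G) *\<^sub>R grad f (ynext G y u)),
      G / (1 + alp G)))"
  define st where "st k = (step ^^ k) (x0, x0, \<Gamma>0)" for k
  have st: "st 0 = (x0, x0, \<Gamma>0)" "\<And>k. st (Suc k) = step (st k)"
    by (simp_all add: st_def)
  define y u G where "y k = fst (st k)" and "u k = fst (snd (st k))" and "G k = snd (snd (st k))"
    for k
  have "accelerated_run f ell x0 \<Gamma>0 Rbar y u G (\<lambda>k. gam (G k)) (\<lambda>k. alp (G k))"
    unfolding accelerated_run_def y_def u_def G_def st step_def
    by (simp add: split_beta gam_def[symmetric] alp_def[symmetric] ynext_def)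
  then show ?thesis by blast
qed

end

theory Submission imports Defs
begin

text \<open>
  The potential \<open>f y\<^sub>k - f x\<^sup>* + \<Gamma>\<^sub>k / 2 * \<parallel>u\<^sub>k - x\<^sup>*\<parallel>\<^sup>2\<close> shrinks by the factor
  \<open>1 / (1 + \<alpha>\<^sub>k)\<close> in every step, as for the accelerated method with the smoothness constant
  \<open>ell (4 * s)\<close>, where \<open>psi s = \<Gamma>\<^sub>k * Rbar\<^sup>2\<close>. The potential being at most \<open>psi s\<close> gives
  \<open>\<parallel>\<nabla>f y\<^sub>k\<parallel> \<le> s\<close>, because \<open>psi \<parallel>\<nabla>f x\<parallel> \<le> f x - f x\<^sup>*\<close>. The smoothness constant enters through
  the cocoercivity inequality between \<open>y\<^sub>k\<close> and the next point, which needs a gradient bound at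
  the next point as well; this bound comes from a continuity argument in the step size.
\<close>

section \<open>Gradient, Hessian and tangent inequality on the domain\<close>

lemma gderiv_grad:
  fixes f :: "real^'d \<Rightarrow> ereal"
  assumes "(\<lambda>z. real_of_ereal (f z)) differentiable (at x)"
  shows "GDERIV (\<lambda>z. real_of_ereal (f z)) x :> grad f x"
proof -
  obtain T where T: "((\<lambda>z. real_of_ereal (f z)) has_derivative T) (at x)"
    using assms unfolding differentiable_def by blast
  \<comment> \<open>Riesz representation of the real-valued linear map \<open>T\<close>: its
    gradient vector is \<open>adjoint T 1\<close>.\<close>
  have "T = (\<lambda>h. inner h (adjoint T 1))"
    using adjoint_works[OF has_derivative_linear[OF T]] by auto
  with T have g: "GDERIV (\<lambda>z. real_of_ereal (f z)) x :> adjoint T 1"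
    unfolding gderiv_def by simp
  show ?thesis
    unfolding grad_def
  proof (rule theI[where P = "\<lambda>g. GDERIV (\<lambda>z. real_of_ereal (f z)) x :> g", OF g])
    fix g assume "GDERIV (\<lambda>z. real_of_ereal (f z)) x :> g"
    then have "(\<lambda>h. inner h g) = (\<lambda>h. inner h (adjoint T 1))"
      using g unfolding gderiv_def by (rule has_derivative_unique)
    then show "g = adjoint T 1"
      by (metis inner_commute vector_eq_ldot)
  qed
qed

text \<open>The standing assumptions on \<open>f\<close> and \<open>ell\<close> alone. A minimiser,
  a lower bound or the monotonicity of \<open>psi ell\<close> is assumed only in the lemmas that
  call for it.\<close>

locale convex_ell_smooth =
  fixes f :: "real^'d \<Rightarrow> ereal" and ell :: "real \<Rightarrow> real"
  assumes proper: "\<And>x. f x \<noteq> -\<infinity>"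
    and dom_open: "open (dom_ext f)"
    and dom_convex: "convex (dom_ext f)"
    and f_convex: "convex_ext f"
    and f_smooth: "ell_smooth ell f"
begin

abbreviation F :: "real^'d \<Rightarrow> real" where "F x \<equiv> real_of_ereal (f x)"

lemma f_eq_F: "x \<in> dom_ext f \<Longrightarrow> f x = ereal (F x)"
  using proper[of x] by (cases "f x") (auto simp: dom_ext_def)

lemma ell_mono: "0 \<le> s \<Longrightarrow> s \<le> t \<Longrightarrow> ell s \<le> ell t"
  using f_smooth unfolding ell_smooth_def by (auto intro: mono_onD[where A = "{0..}"])

lemma ell_pos: "0 \<le> s \<Longrightarrow> 0 < ell s"
  using f_smooth unfolding ell_smooth_def by auto

lemma F_has_derivative:
  assumes "x \<in> dom_ext f"
  shows "(F has_derivative (\<lambda>h. inner h (grad f x))) (at x)"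
  using assms f_smooth gderiv_grad[of f x]
  unfolding ell_smooth_def twice_differentiable_def gderiv_def by blast

lemma F_has_real_derivative_line:
  assumes "x + t *\<^sub>R w \<in> dom_ext f"
  shows "((\<lambda>t. F (x + t *\<^sub>R w)) has_real_derivative inner w (grad f (x + t *\<^sub>R w))) (at t within S)"
proof -
  have "((\<lambda>t. x + t *\<^sub>R w) has_derivative (\<lambda>h. h *\<^sub>R w)) (at t within S)"
    by (auto intro!: derivative_eq_intros)
  from has_derivative_compose[OF this F_has_derivative[OF assms]]
  show ?thesis
    unfolding has_field_derivative_def by (simp add: mult_commute_abs)
qed

lemma continuous_on_grad: "continuous_on (dom_ext f) (grad f)"
  using f_smooth unfolding ell_smooth_def twice_differentiable_def
  by (meson continuous_at_imp_continuous_on differentiable_imp_continuous_within)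

text \<open>\<open>hess\<close> is the matrix of the derivative of the gradient, so its spectral
  norm is the operator norm of that derivative. This puts the smoothness assumption in the form that
  the mean value inequality takes.\<close>

lemma grad_has_derivative:
  assumes "x \<in> dom_ext f"
  shows "(grad f has_derivative frechet_derivative (grad f) (at x)) (at x)"
    and "onorm (frechet_derivative (grad f) (at x)) \<le> ell (norm (grad f x))"
proof -
  let ?D = "frechet_derivative (grad f) (at x)"
  show D: "(grad f has_derivative ?D) (at x)"
    using assms f_smooth unfolding ell_smooth_def twice_differentiable_def
    by (simp add: frechet_derivative_works)
  have "(\<lambda>v. matrix ?D *v v) = ?D"
    by (rule matrix_vector_mul(2)[OF has_derivative_linear[OF D]])
  then show "onorm ?D \<le> ell (norm (grad f x))"
    using assms f_smooth unfolding ell_smooth_def spectral_norm_def hess_def by fastforce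
qed

lemma convex_on_F: "convex_on (dom_ext f) F"
proof (rule convex_onI[OF _ dom_convex])
  fix t x y assume t: "0 < t" "t < (1::real)" and xy: "x \<in> dom_ext f" "y \<in> dom_ext f"
  then have z: "(1 - t) *\<^sub>R x + t *\<^sub>R y \<in> dom_ext f"
    using dom_convex by (simp add: convex_def)
  have "f ((1 - t) *\<^sub>R x + t *\<^sub>R y) \<le> ereal (1 - t) * f x + ereal t * f y"
    using f_convex t unfolding convex_ext_def by auto
  moreover obtain a b c where "f ((1 - t) *\<^sub>R x + t *\<^sub>R y) = ereal a" "f x = ereal b" "f y = ereal c"
    using f_eq_F z xy by blast
  ultimately show "F ((1 - t) *\<^sub>R x + t *\<^sub>R y) \<le> (1 - t) * F x + t * F y"
    by simp
qed

text \<open>Restricting \<open>F\<close> to the line through \<open>y\<close> and \<open>z\<close>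
  gives a convex function of one real variable on the open interval \<open>A\<close> of admissible
  parameters, where the one-dimensional tangent inequality applies at \<open>0\<close>.\<close>

lemma F_above_tangent:
  assumes y: "y \<in> dom_ext f" and z: "z \<in> dom_ext f"
  shows "F y + inner (grad f y) (z - y) \<le> F z"
proof -
  define A where "A = (\<lambda>t::real. y + t *\<^sub>R (z - y)) -` dom_ext f"
  have "open A"
    unfolding A_def by (intro open_vimage dom_open continuous_intros)
  moreover have convA: "convex A"
    unfolding convex_def A_def
  proof clarsimp
    fix s t u v :: real
    assume a: "y + s *\<^sub>R (z - y) \<in> dom_ext f" "y + t *\<^sub>R (z - y) \<in> dom_ext f"
      "0 \<le> u" "0 \<le> v" "u + v = 1"
    have "u *\<^sub>R (y + s *\<^sub>R (z - y)) + v *\<^sub>R (y + t *\<^sub>R (z - y)) \<in> dom_ext f"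
      using dom_convex a by (simp add: convex_def)
    also have "u *\<^sub>R (y + s *\<^sub>R (z - y)) + v *\<^sub>R (y + t *\<^sub>R (z - y)) =
        (u + v) *\<^sub>R y + (u * s + v * t) *\<^sub>R (z - y)"
      by (simp add: algebra_simps)
    finally show "y + (u * s + v * t) *\<^sub>R (z - y) \<in> dom_ext f" using a by simp
  qed
  moreover have "convex_on A (\<lambda>t. F (y + t *\<^sub>R (z - y)))"
  proof (rule convex_onI[OF _ convA])
    fix t r s :: real assume t: "0 < t" "t < 1" and rs: "r \<in> A" "s \<in> A"
    have "y + ((1 - t) *\<^sub>R r + t *\<^sub>R s) *\<^sub>R (z - y) =
        (1 - t) *\<^sub>R (y + r *\<^sub>R (z - y)) + t *\<^sub>R (y + s *\<^sub>R (z - y))"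
      by (simp add: algebra_simps)
    then show "F (y + ((1 - t) *\<^sub>R r + t *\<^sub>R s) *\<^sub>R (z - y)) \<le>
        (1 - t) * F (y + r *\<^sub>R (z - y)) + t * F (y + s *\<^sub>R (z - y))"
      using convex_onD[OF convex_on_F, of t] t rs by (simp add: A_def)
  qed
  moreover have "0 \<in> A" "1 \<in> A" using y z by (simp_all add: A_def)
  ultimately have "inner (z - y) (grad f y) * (1 - 0) \<le> F (y + 1 *\<^sub>R (z - y)) - F (y + 0 *\<^sub>R (z - y))"
    using F_has_real_derivative_line[of y 0 "z - y" A] y
    by (intro convex_on_imp_above_tangent[of A "\<lambda>t. F (y + t *\<^sub>R (z - y))"])
      (auto simp: interior_open convex_connected)
  then show ?thesis by (simp add: inner_commute)
qed

section \<open>Gradient bounds along rays and the descent inequality\<close>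

text \<open>Mean value inequality: as \<open>ell\<close> is non-decreasing, a gradient bound
  \<open>M\<close> on the segment makes \<open>ell M\<close> a Lipschitz constant of the gradient
  there.\<close>

lemma grad_diff_le_on_segment:
  assumes "0 \<le> t"
    and dom: "\<And>\<tau>. 0 \<le> \<tau> \<Longrightarrow> \<tau> \<le> t \<Longrightarrow> x + \<tau> *\<^sub>R w \<in> dom_ext f"
    and bd: "\<And>\<tau>. 0 \<le> \<tau> \<Longrightarrow> \<tau> \<le> t \<Longrightarrow> norm (grad f (x + \<tau> *\<^sub>R w)) \<le> M"
  shows "norm (grad f (x + t *\<^sub>R w) - grad f x) \<le> ell M * (t * norm w)"
proof -
  let ?S = "closed_segment x (x + t *\<^sub>R w)"
  have S: "z \<in> dom_ext f \<and> norm (grad f z) \<le> M" if z: "z \<in> ?S" for z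
  proof -
    obtain c where c: "0 \<le> c" "c \<le> 1" "z = (1 - c) *\<^sub>R x + c *\<^sub>R (x + t *\<^sub>R w)"
      using z unfolding closed_segment_def by blast
    then have "z = x + (c * t) *\<^sub>R w" by (simp add: algebra_simps)
    moreover have "0 \<le> c * t" "c * t \<le> t" using c assms(1) by (simp_all add: mult_left_le_one_le)
    ultimately show ?thesis using dom bd by blast
  qed
  have "norm (grad f (x + t *\<^sub>R w) - grad f x) \<le> ell M * norm (x + t *\<^sub>R w - x)"
  proof (rule differentiable_bound[of ?S])
    fix z assume z: "z \<in> ?S"
    show "(grad f has_derivative frechet_derivative (grad f) (at z)) (at z within ?S)"
      using grad_has_derivative(1) S[OF z] has_derivative_at_withinI by blast
    show "onorm (frechet_derivative (grad f) (at z)) \<le> ell M"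
      using grad_has_derivative(2)[of z] S[OF z] ell_mono[of "norm (grad f z)" M] by force
  qed auto
  then show ?thesis using assms(1) by simp
qed

text \<open>
  Bootstrapping: at the first parameter where the ray leaves \<open>{z \<in> dom_ext f. norm (grad f z) < M}\<close>,
  the bound on \<open>f\<close> along the ray excludes a boundary point of the domain, where \<open>f = \<infinity>\<close>, and
  the bound on the gradient is still strict.
\<close>

lemma ray_stays_in_sublevel:
  assumes x: "x \<in> dom_ext f" and M: "norm (grad f x) + ell M * norm w < M"
    and "0 < M" "0 \<le> t" "t \<le> 1"
  shows "x + t *\<^sub>R w \<in> dom_ext f \<and> norm (grad f (x + t *\<^sub>R w)) < M"
proof (rule ccontr)
  assume bad: "\<not> ?thesis"
  define p where "p \<tau> = x + \<tau> *\<^sub>R w" for \<tau> :: real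
  define U where "U = {z \<in> dom_ext f. norm (grad f z) < M}"
  have cont_p: "continuous_on S p" for S
    unfolding p_def by (intro continuous_intros)
  have "U = dom_ext f \<inter> (\<lambda>z. norm (grad f z)) -` {..<M}"
    by (auto simp: U_def)
  then have "open U"
    using continuous_open_preimage[OF continuous_on_norm[OF continuous_on_grad] dom_open open_lessThan]
    by simp
  then have "closed (p -` (- U))"
    by (intro closed_vimage cont_p) auto
  then have "compact ({0..1} \<inter> p -` (- U))"
    by (intro compact_Int_closed) auto
  moreover have "t \<in> {0..1} \<inter> p -` (- U)"
    using bad assms by (auto simp: U_def p_def)
  ultimately obtain t0 where t0: "t0 \<in> {0..1}" "p t0 \<notin> U"
    and min: "\<And>\<tau>. \<tau> \<in> {0..1} \<Longrightarrow> p \<tau> \<notin> U \<Longrightarrow> t0 \<le> \<tau>"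
    using compact_attains_inf[of "{0..1} \<inter> p -` (- U)"] by blast
  have good: "p \<tau> \<in> U" if "0 \<le> \<tau>" "\<tau> < t0" for \<tau>
    using min[of \<tau>] that t0 by force
  have "0 < ell M" using \<open>0 < M\<close> by (simp add: ell_pos)
  have "t0 \<noteq> 0"
  proof
    assume "t0 = 0"
    then have "p t0 = x" by (simp add: p_def)
    moreover have "norm (grad f x) < M"
      using M \<open>0 < ell M\<close> by (smt (verit) norm_ge_zero mult_nonneg_nonneg)
    ultimately show False using t0 x by (simp add: U_def)
  qed
  with t0 have t0: "0 < t0" "t0 \<le> 1" "p t0 \<notin> U" by auto
  have ev: "eventually (\<lambda>\<tau>. 0 \<le> \<tau> \<and> \<tau> < t0) (at_left t0)"
    unfolding eventually_at_left_field using t0 by (auto intro!: exI[of _ 0])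
  have lim_p: "(p \<longlongrightarrow> p t0) (at_left t0)"
    using cont_p[of UNIV] by (auto simp: continuous_on_def intro: tendsto_within_subset)
  have dom: "p t0 \<in> dom_ext f"
  proof (rule ccontr)
    assume "p t0 \<notin> dom_ext f"
    then have inf: "f (p t0) = \<infinity>" by (simp add: dom_ext_def)
    have "eventually (\<lambda>\<tau>. p \<tau> \<in> closure (dom_ext f)) (at_left t0)"
      using ev
    proof eventually_elim
      case (elim \<tau>)
      then show ?case using good[of \<tau>] closure_subset[of "dom_ext f"] by (auto simp: U_def)
    qed
    moreover have "p t0 \<in> closure (dom_ext f)"
      by (rule Lim_in_closed_set[OF closed_closure calculation _ lim_p]) simp
    moreover have "continuous_on (closure (dom_ext f)) f"
      using f_smooth by (simp add: ell_smooth_def)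
    ultimately have "((\<lambda>\<tau>. f (p \<tau>)) \<longlongrightarrow> f (p t0)) (at_left t0)"
      using continuous_on_tendsto_compose lim_p by blast
    moreover have "eventually (\<lambda>\<tau>. ereal (F x + M * norm w) \<ge> f (p \<tau>)) (at_left t0)"
      using ev
    proof eventually_elim
      case (elim \<tau>)
      then have "p \<tau> \<in> U" using good by simp
      then have p: "p \<tau> \<in> dom_ext f" "norm (grad f (p \<tau>)) < M" by (auto simp: U_def)
      \<comment> \<open>The tangent is taken at \<open>p \<tau>\<close> and evaluated at
        \<open>x\<close>; this bounds \<open>F (p \<tau>)\<close> from above by means of the
        gradient at \<open>p \<tau>\<close>, which is below \<open>M\<close>.\<close>
      have "F (p \<tau>) \<le> F x + inner (grad f (p \<tau>)) (p \<tau> - x)"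
        using F_above_tangent[OF p(1) x] by (simp add: inner_diff_right)
      also have "inner (grad f (p \<tau>)) (p \<tau> - x) \<le> norm (grad f (p \<tau>)) * norm (p \<tau> - x)"
        by (rule norm_cauchy_schwarz)
      also have "\<dots> \<le> M * norm w"
        using p(2) elim t0 \<open>0 < M\<close> by (intro mult_mono) (auto simp: p_def mult_left_le_one_le)
      finally show ?case by (subst f_eq_F[OF p(1)]) simp
    qed
    ultimately have "f (p t0) \<le> ereal (F x + M * norm w)"
      by (rule tendsto_upperbound) simp
    then show False using inf by simp
  qed
  have "norm (grad f (p t0)) \<le> M"
  proof (rule tendsto_upperbound)
    show "((\<lambda>\<tau>. norm (grad f (p \<tau>))) \<longlongrightarrow> norm (grad f (p t0))) (at_left t0)"
    proof (rule tendsto_norm, rule continuous_on_tendsto_compose[OF continuous_on_grad lim_p dom])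
      show "eventually (\<lambda>\<tau>. p \<tau> \<in> dom_ext f) (at_left t0)"
        using ev
      proof eventually_elim
        case (elim \<tau>)
        then show ?case using good[of \<tau>] by (simp add: U_def)
      qed
    qed
    show "eventually (\<lambda>\<tau>. M \<ge> norm (grad f (p \<tau>))) (at_left t0)"
      using ev
    proof eventually_elim
      case (elim \<tau>)
      then show ?case using good[of \<tau>] by (simp add: U_def less_imp_le)
    qed
  qed simp
  then have gd: "p \<tau> \<in> dom_ext f \<and> norm (grad f (p \<tau>)) \<le> M" if "0 \<le> \<tau>" "\<tau> \<le> t0" for \<tau>
    using good[of \<tau>] dom that by (cases "\<tau> = t0") (auto simp: U_def)
  \<comment> \<open>The bound \<open>M\<close>, now known up to and including \<open>t0\<close>,
    limits the change of the gradient, and the slack in the hypothesis on \<open>M\<close> makes the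
    bound at \<open>t0\<close> strict.\<close>
  have "norm (grad f (p t0) - grad f x) \<le> ell M * (t0 * norm w)"
    unfolding p_def
    by (intro grad_diff_le_on_segment)
      (use t0 gd[unfolded p_def] in auto)
  also have "\<dots> \<le> ell M * norm w"
    using t0 \<open>0 < ell M\<close> by (simp add: mult_left_le_one_le)
  finally have "norm (grad f (p t0)) < M"
    using M norm_triangle_sub[of "grad f (p t0)" "grad f x"] by linarith
  then show False using dom t0 by (simp add: U_def)
qed

text \<open>The condition on \<open>M\<close> keeps the whole segment from \<open>x\<close> to
  \<open>x + w\<close> where the gradient is below \<open>M\<close>, so the usual quadratic upper
  model holds with constant \<open>ell M\<close>.\<close>

lemma descent:
  assumes x: "x \<in> dom_ext f" and M: "norm (grad f x) + ell M * norm w < M" "0 < M"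
  shows "x + w \<in> dom_ext f"
    and "F (x + w) \<le> F x + inner (grad f x) w + ell M / 2 * (norm w)\<^sup>2"
proof -
  note ray = ray_stays_in_sublevel[OF x M]
  show "x + w \<in> dom_ext f"
    using ray[of 1] by simp
  \<comment> \<open>\<open>F\<close> along the ray minus the linear and quadratic terms of the
    model; the Lipschitz bound on the gradient makes its derivative nonpositive.\<close>
  define \<phi> where "\<phi> t = F (x + t *\<^sub>R w) - t * inner w (grad f x) - ell M * (norm w)\<^sup>2 * t\<^sup>2 / 2"
    for t :: real
  have "\<phi> 1 \<le> \<phi> 0"
  proof (rule DERIV_nonpos_imp_nonincreasing[where f = \<phi>])
    fix t :: real assume t: "0 \<le> t" "t \<le> 1"
    have "(\<phi> has_real_derivative inner w (grad f (x + t *\<^sub>R w)) - inner w (grad f x)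
        - ell M * (norm w)\<^sup>2 * t) (at t)"
      unfolding \<phi>_def
      by (rule derivative_eq_intros F_has_real_derivative_line refl | use ray[of t] t in simp)+
    moreover have "inner w (grad f (x + t *\<^sub>R w) - grad f x) \<le> norm w * (ell M * (t * norm w))"
      using ray t
      by (intro order_trans[OF norm_cauchy_schwarz] mult_left_mono grad_diff_le_on_segment)
        (auto intro: less_imp_le)
    ultimately show "\<exists>y. DERIV \<phi> t :> y \<and> y \<le> 0"
      by (intro exI conjI) (auto simp: inner_diff_right power2_eq_square algebra_simps)
  qed simp
  then show "F (x + w) \<le> F x + inner (grad f x) w + ell M / 2 * (norm w)\<^sup>2"
    by (simp add: \<phi>_def inner_commute)
qed

section \<open>Cocoercivity and the gradient bound from the function gap\<close>

text \<open>At \<open>x + w\<close> the tangent at \<open>y\<close> lies below \<open>F\<close> and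
  the quadratic model at \<open>x\<close> lies above it. The choice of \<open>w\<close> minimises
  the difference of model and tangent, and \<open>ell M * norm w = norm d\<close> turns the
  hypothesis on \<open>M\<close> into that of \<open>descent\<close>.\<close>

lemma cocoercive:
  assumes x: "x \<in> dom_ext f" and y: "y \<in> dom_ext f"
    and M: "norm (grad f x) + norm (grad f x - grad f y) < M"
  shows "F y + inner (grad f y) (x - y) + (norm (grad f x - grad f y))\<^sup>2 / (2 * ell M) \<le> F x"
proof -
  define d where "d = grad f x - grad f y"
  define w where "w = (- (1 / ell M)) *\<^sub>R d"
  have "0 < M" using M by (smt (verit) norm_ge_zero)
  then have L: "0 < ell M" by (simp add: ell_pos)
  then have "norm (grad f x) + ell M * norm w < M"
    using M by (simp add: w_def d_def)
  note desc = descent[OF x this \<open>0 < M\<close>]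
  have "F y + inner (grad f y) (x + w - y) \<le> F (x + w)"
    by (rule F_above_tangent[OF y desc(1)])
  also have "\<dots> \<le> F x + inner (grad f x) w + ell M / 2 * (norm w)\<^sup>2"
    by (rule desc(2))
  finally have "F y + inner (grad f y) (x - y) - inner d w - ell M / 2 * (norm w)\<^sup>2 \<le> F x"
    by (simp add: d_def algebra_simps)
  moreover have "inner d w = - ((norm d)\<^sup>2 / ell M)"
    by (simp add: w_def power2_norm_eq_inner)
  moreover have "ell M / 2 * (norm w)\<^sup>2 = (norm d)\<^sup>2 / (2 * ell M)"
    using L by (simp add: w_def power_mult_distrib power_divide power2_eq_square field_simps)
  moreover have "(norm d)\<^sup>2 / ell M = 2 * ((norm d)\<^sup>2 / (2 * ell M))" by simp
  ultimately show ?thesis unfolding d_def by linarith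
qed

text \<open>With \<open>a\<close> the gradient norm at \<open>x\<close>, a gradient step of size
  \<open>1 / ell (4 * a)\<close> lowers \<open>F\<close> by at least \<open>psi ell a\<close>, yet
  not below \<open>m\<close>. Such a step is admissible for \<open>descent\<close> because
  \<open>a + a < 4 * a\<close>, which is strict only for a nonzero gradient; hence the case
  split.\<close>

lemma psi_grad_le:
  assumes x: "x \<in> dom_ext f" and m: "\<And>z. z \<in> dom_ext f \<Longrightarrow> m \<le> F z"
  shows "psi ell (norm (grad f x)) \<le> F x - m"
proof (cases "grad f x = 0")
  case True
  then show ?thesis using m[OF x] by (simp add: psi_def)
next
  case False
  define a where "a = norm (grad f x)"
  have a: "0 < a" using False by (simp add: a_def)
  then have L: "0 < ell (4 * a)" by (simp add: ell_pos)
  define w where "w = (- (1 / ell (4 * a))) *\<^sub>R grad f x"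
  have "norm (grad f x) + ell (4 * a) * norm w < 4 * a"
    using a L by (simp add: w_def a_def)
  note desc = descent[OF x this]
  have "m \<le> F x + inner (grad f x) w + ell (4 * a) / 2 * (norm w)\<^sup>2"
    using desc m a by (meson order_trans zero_less_mult_iff zero_less_numeral)
  moreover have "inner (grad f x) w = - (a\<^sup>2 / ell (4 * a))"
    by (simp add: w_def power2_norm_eq_inner a_def)
  moreover have "ell (4 * a) / 2 * (norm w)\<^sup>2 = a\<^sup>2 / (2 * ell (4 * a))"
    using L by (simp add: w_def a_def[symmetric] power_mult_distrib power_divide power2_eq_square field_simps)
  moreover have "a\<^sup>2 / ell (4 * a) = 2 * (a\<^sup>2 / (2 * ell (4 * a)))" by simp
  ultimately show ?thesis unfolding psi_def a_def[symmetric] by linarith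
qed

section \<open>One step of the accelerated method\<close>

text \<open>The update of \<open>y\<close>, with \<gamma> and \<alpha> left free so that the step
  size can be varied continuously.\<close>

definition accel_point :: "real^'d \<Rightarrow> real^'d \<Rightarrow> real \<Rightarrow> real \<Rightarrow> real^'d" where
  "accel_point x u \<gamma> \<alpha> = (1 / (1 + \<alpha>)) *\<^sub>R x + (\<alpha> / (1 + \<alpha>)) *\<^sub>R u - (\<gamma> / (1 + \<alpha>)) *\<^sub>R grad f x"

text \<open>The point is a convex combination of the gradient step from \<open>x\<close>, which lies
  in the open domain by \<open>descent\<close>, and of \<open>u\<close> in the closure. The former
  has the positive weight \<open>1 / (1 + \<alpha>)\<close>, so the combination is interior.\<close>

lemma accel_point_in_dom:
  assumes x: "x \<in> dom_ext f" and u: "u \<in> closure (dom_ext f)"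
    and s: "norm (grad f x) \<le> s" "0 < s"
    and \<gamma>: "0 \<le> \<gamma>" "\<gamma> * ell (4 * s) \<le> 1" and \<alpha>: "0 \<le> \<alpha>"
  shows "accel_point x u \<gamma> \<alpha> \<in> dom_ext f"
proof -
  have "ell (4 * s) * norm ((- \<gamma>) *\<^sub>R grad f x) \<le> norm (grad f x)"
    using mult_right_mono[OF \<gamma>(2), of "norm (grad f x)"] \<gamma> by (simp add: mult_ac)
  then have "norm (grad f x) + ell (4 * s) * norm ((- \<gamma>) *\<^sub>R grad f x) < 4 * s"
    using s by linarith
  then have "x + (- \<gamma>) *\<^sub>R grad f x \<in> dom_ext f"
    by (rule descent(1)[OF x]) (use s in simp)
  then have "u - (1 / (1 + \<alpha>)) *\<^sub>R (u - (x + (- \<gamma>) *\<^sub>R grad f x)) \<in> interior (dom_ext f)"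
    using u \<alpha> by (intro mem_interior_closure_convex_shrink dom_convex)
      (simp_all add: interior_open dom_open)
  moreover have "u - (1 / (1 + \<alpha>)) *\<^sub>R (u - (x + (- \<gamma>) *\<^sub>R grad f x)) = accel_point x u \<gamma> \<alpha>"
  proof -
    have "\<alpha> / (1 + \<alpha>) = 1 - 1 / (1 + \<alpha>)" using \<alpha> by (simp add: field_simps)
    then show ?thesis unfolding accel_point_def by (simp only:) (simp add: algebra_simps)
  qed
  ultimately show ?thesis using interior_subset by auto
qed

text \<open>Three inequalities are added: cocoercivity between \<open>x\<close> and
  \<open>y\<close>, \<alpha> times the tangent inequality from \<open>y\<close> to \<open>z\<close>,
  and nonexpansiveness of the projection. By \<open>\<alpha>\<^sup>2 = \<gamma> * \<Gamma>\<close>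
  all terms in \<open>h\<close> cancel, and a nonnegative multiple of
  \<open>(norm g)\<^sup>2\<close> is dropped.\<close>

lemma lyapunov_step:
  fixes x u z :: "real^'d" and \<gamma> \<Gamma> :: real
  defines "\<alpha> \<equiv> sqrt (\<gamma> * \<Gamma>)"
  defines "y \<equiv> accel_point x u \<gamma> \<alpha>"
  assumes x: "x \<in> dom_ext f" and y: "y \<in> dom_ext f" and z: "z \<in> dom_ext f"
    and gx: "norm (grad f x) \<le> s" and gy: "norm (grad f y) < 2 * s" and s: "0 < s"
    and \<gamma>: "0 \<le> \<gamma>" "\<gamma> * ell (4 * s) \<le> 1" and \<Gamma>: "0 < \<Gamma>"
  shows "(1 + \<alpha>) * F y
      + \<Gamma> / 2 * (norm (closest_point (closure (dom_ext f)) (u - (\<alpha> / \<Gamma>) *\<^sub>R grad f y) - z))\<^sup>2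
    \<le> F x + \<alpha> * F z + \<Gamma> / 2 * (norm (u - z))\<^sup>2"
proof -
  define g where "g = grad f x"
  define h where "h = grad f y"
  define v where "v = u - (\<alpha> / \<Gamma>) *\<^sub>R h"
  have \<alpha>: "0 \<le> \<alpha>" "\<alpha>\<^sup>2 = \<gamma> * \<Gamma>" using \<gamma> \<Gamma> by (simp_all add: \<alpha>_def)
  have L: "0 < ell (4 * s)" using s by (simp add: ell_pos)
  \<comment> \<open>The left side is at most \<open>2 * norm g + norm h\<close>, which explains the
    bound \<open>2 * s\<close> on the gradient at \<open>y\<close> and the argument
    \<open>4 * s\<close> of \<open>ell\<close>.\<close>
  have "norm g + norm (g - h) < 4 * s"
    using gx gy norm_triangle_ineq4[of g h] unfolding g_def h_def by linarith
  then have "F y + inner h (x - y) + (norm (g - h))\<^sup>2 / (2 * ell (4 * s)) \<le> F x"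
    using cocoercive[OF x y] unfolding g_def h_def by blast
  moreover have "\<gamma> / 2 * (norm (g - h))\<^sup>2 \<le> (norm (g - h))\<^sup>2 / (2 * ell (4 * s))"
    using \<gamma>(2) L mult_right_mono[of "\<gamma>" "1 / ell (4 * s)" "(norm (g - h))\<^sup>2"]
    by (simp add: pos_le_divide_eq)
  ultimately have fx: "F y + inner h (x - y) + \<gamma> / 2 * (norm (g - h))\<^sup>2 \<le> F x" by linarith
  have "F y + inner h (z - y) \<le> F z"
    unfolding h_def by (rule F_above_tangent[OF y z])
  from mult_left_mono[OF this \<alpha>(1)]
  have fz: "\<alpha> * F y + \<alpha> * inner h (z - y) \<le> \<alpha> * F z" by (simp add: algebra_simps)
  have y_eq: "(1 + \<alpha>) *\<^sub>R y = x + \<alpha> *\<^sub>R u - \<gamma> *\<^sub>R g"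
    using \<alpha>(1) unfolding y_def accel_point_def g_def
    by (simp add: scaleR_add_right scaleR_diff_right)
  have "inner h (x - y) + \<alpha> * inner h (z - y) = inner h (x + \<alpha> *\<^sub>R z - (1 + \<alpha>) *\<^sub>R y)"
    by (simp add: algebra_simps)
  also have "\<dots> = \<gamma> * inner h g - \<alpha> * inner h (u - z)"
    unfolding y_eq by (simp add: algebra_simps)
  finally have lin: "inner h (x - y) + \<alpha> * inner h (z - y) = \<gamma> * inner h g - \<alpha> * inner h (u - z)" .
  have sq: "(norm (g - h))\<^sup>2 = (norm g)\<^sup>2 - 2 * inner h g + (norm h)\<^sup>2"
    by (simp add: power2_norm_eq_inner inner_commute algebra_simps)
  have gsq: "\<gamma> / 2 * (norm (g - h))\<^sup>2 = \<gamma> / 2 * (norm g)\<^sup>2 - \<gamma> * inner h g + \<gamma> / 2 * (norm h)\<^sup>2"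
    unfolding sq by (simp add: algebra_simps)
  \<comment> \<open>Used with \<open>c = \<alpha> / \<Gamma>\<close>, where
    \<open>\<Gamma> * c\<close> is \<alpha> and \<open>\<Gamma> * c\<^sup>2\<close> is
    \<gamma>.\<close>
  have expand: "\<Gamma> / 2 * (a - 2 * c * b + c\<^sup>2 * e) = \<Gamma> / 2 * a - \<Gamma> * c * b + \<Gamma> * c\<^sup>2 / 2 * e"
    for a b c e :: real
    by (simp add: algebra_simps)
  have "dist (closest_point (closure (dom_ext f)) v) (closest_point (closure (dom_ext f)) z) \<le> dist v z"
    by (rule closest_point_lipschitz) (use z dom_convex in \<open>auto simp: convex_closure\<close>)
  moreover have "closest_point (closure (dom_ext f)) z = z"
    using z closure_subset by (intro closest_point_self) auto
  ultimately have "(norm (closest_point (closure (dom_ext f)) v - z))\<^sup>2 \<le> (norm (v - z))\<^sup>2"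
    by (simp add: dist_norm power_mono)
  then have "\<Gamma> / 2 * (norm (closest_point (closure (dom_ext f)) v - z))\<^sup>2 \<le> \<Gamma> / 2 * (norm (v - z))\<^sup>2"
    using \<Gamma> by simp
  moreover have "(norm (v - z))\<^sup>2 =
      (norm (u - z))\<^sup>2 - 2 * (\<alpha> / \<Gamma>) * inner h (u - z) + (\<alpha> / \<Gamma>)\<^sup>2 * (norm h)\<^sup>2"
    unfolding v_def power2_norm_eq_inner
    by (simp add: inner_diff_left inner_diff_right inner_commute power2_eq_square
        diff_divide_distrib right_diff_distrib)
  moreover have "\<Gamma> * (\<alpha> / \<Gamma>) = \<alpha>" using \<Gamma> by simp
  moreover have "\<Gamma> * (\<alpha> / \<Gamma>)\<^sup>2 = \<gamma>"
    unfolding power_divide \<alpha>(2) using \<Gamma> by (simp add: power2_eq_square)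
  ultimately have pr: "\<Gamma> / 2 * (norm (closest_point (closure (dom_ext f)) v - z))\<^sup>2 \<le>
      \<Gamma> / 2 * (norm (u - z))\<^sup>2 - \<alpha> * inner h (u - z) + \<gamma> / 2 * (norm h)\<^sup>2"
    using expand[of "(norm (u - z))\<^sup>2" "\<alpha> / \<Gamma>" "inner h (u - z)" "(norm h)\<^sup>2"] by simp
  have "0 \<le> \<gamma> / 2 * (norm g)\<^sup>2" using \<gamma> by simp
  moreover have "(1 + \<alpha>) * F y = F y + \<alpha> * F y" by (simp add: algebra_simps)
  ultimately show ?thesis
    using fx fz lin gsq pr unfolding h_def[symmetric] v_def[symmetric] by linarith
qed

text \<open>
  The inequality of the previous lemma presupposes \<open>norm (grad f y) < 2 * s\<close>. To get rid of this,
  let the step size grow from \<open>0\<close>: the gradient norm at the trial point depends on it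
  continuously, starts below \<open>s\<close>, and can never take a value strictly between \<open>s\<close> and \<open>2 * s\<close>,
  since there the Lyapunov inequality bounds it by \<open>s\<close>.
\<close>

lemma norm_grad_accel_point_le:
  assumes x: "x \<in> dom_ext f" and u: "u \<in> closure (dom_ext f)"
    and z: "z \<in> dom_ext f" and z_min: "\<And>w. w \<in> dom_ext f \<Longrightarrow> F z \<le> F w"
    and psi_strict: "strict_mono_on {0..} (psi ell)"
    and s: "0 < s" and gx: "norm (grad f x) \<le> s"
    and \<Gamma>: "0 < \<Gamma>" and V: "F x - F z + \<Gamma> / 2 * (norm (u - z))\<^sup>2 \<le> psi ell s"
    and \<gamma>: "0 \<le> \<gamma>" "\<gamma> * ell (4 * s) \<le> 1"
  shows "norm (grad f (accel_point x u \<gamma> (sqrt (\<gamma> * \<Gamma>)))) \<le> s"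
proof (rule ccontr)
  define p where "p c = accel_point x u c (sqrt (c * \<Gamma>))" for c
  define \<theta> where "\<theta> c = norm (grad f (p c))" for c
  assume "\<not> ?thesis"
  then have big: "s < \<theta> \<gamma>" by (simp add: \<theta>_def p_def)
  have step: "c * ell (4 * s) \<le> 1" if "c \<le> \<gamma>" for c
    using mult_right_mono[OF that, of "ell (4 * s)"] ell_pos[of "4 * s"] s \<gamma> by linarith
  have p_dom: "p c \<in> dom_ext f" if "0 \<le> c" "c \<le> \<gamma>" for c
    unfolding p_def using that \<Gamma> step[of c] by (intro accel_point_in_dom[OF x u gx s]) simp_all
  have "1 + sqrt (c * \<Gamma>) \<noteq> 0" if "0 \<le> c" for c
    using that \<Gamma> real_sqrt_ge_zero[of "c * \<Gamma>"] by (simp add: add_nonneg_eq_0_iff)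
  then have "continuous_on {0..\<gamma>} p"
    unfolding p_def accel_point_def by (intro continuous_intros) auto
  then have cont: "continuous_on {0..\<gamma>} \<theta>"
    unfolding \<theta>_def
    by (intro continuous_on_norm continuous_on_compose2[OF continuous_on_grad]) (auto intro: p_dom)
  \<comment> \<open>A forbidden value strictly between \<open>s\<close> and \<open>2 * s\<close>;
    being at most \<open>\<theta> \<gamma>\<close>, it is attained by the intermediate value
    theorem.\<close>
  define c where "c = min (3 / 2 * s) (\<theta> \<gamma>)"
  have c: "s < c" "c < 2 * s" "c \<le> \<theta> \<gamma>" using big s by (auto simp: c_def)
  \<comment> \<open>For step size \<open>0\<close> the weight \<open>sqrt (0 * \<Gamma>)\<close>
    vanishes too.\<close>
  have "p 0 = x" by (simp add: p_def accel_point_def)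
  then have "\<theta> 0 \<le> c" using gx c by (simp add: \<theta>_def)
  then obtain t where t: "0 \<le> t" "t \<le> \<gamma>" "\<theta> t = c"
    using IVT'[OF _ c(3) \<gamma>(1) cont] by auto
  define A where "A = sqrt (t * \<Gamma>)"
  have A: "0 \<le> A" using t \<Gamma> by (simp add: A_def)
  have pt: "p t = accel_point x u t A" by (simp add: p_def A_def)
  \<comment> \<open>The Lyapunov inequality applies at step size \<open>t\<close> since
    \<open>\<theta> t = c < 2 * s\<close>; its distance term on the left is dropped.\<close>
  have "(1 + A) * F (p t) \<le> F x + A * F z + \<Gamma> / 2 * (norm (u - z))\<^sup>2"
  proof -
    have "0 \<le> \<Gamma> / 2 * (norm (closest_point (closure (dom_ext f)) (u - (A / \<Gamma>) *\<^sub>R grad f (p t)) - z))\<^sup>2"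
      using \<Gamma> by simp
    moreover have "(1 + A) * F (p t)
        + \<Gamma> / 2 * (norm (closest_point (closure (dom_ext f)) (u - (A / \<Gamma>) *\<^sub>R grad f (p t)) - z))\<^sup>2
      \<le> F x + A * F z + \<Gamma> / 2 * (norm (u - z))\<^sup>2"
      using lyapunov_step[of x u t \<Gamma> z s] x z gx s \<Gamma> step[of t] t c p_dom[OF t(1,2)]
      by (simp add: pt A_def \<theta>_def)
    ultimately show ?thesis by linarith
  qed
  then have "(1 + A) * (F (p t) - F z) \<le> psi ell s"
    using V by (simp add: algebra_simps)
  moreover have "0 \<le> A * (F (p t) - F z)"
    using A z_min[OF p_dom[OF t(1,2)]] by simp
  ultimately have "F (p t) - F z \<le> psi ell s" by (simp add: algebra_simps)
  then have "psi ell c \<le> psi ell s"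
    using psi_grad_le[OF p_dom[OF t(1,2)] z_min] t(3) by (simp add: \<theta>_def)
  moreover have "psi ell s < psi ell c"
    using psi_strict c s by (auto intro: strict_mono_onD[where A = "{0..}"])
  ultimately show False by simp
qed

section \<open>Inverting \<open>psi\<close>\<close>

lemma continuous_on_ell: "continuous_on {0..} ell"
  unfolding continuous_on_eq_continuous_within
proof
  fix s :: real assume s: "s \<in> {0..}"
  have "locally_lipschitz_nonneg ell"
    using f_smooth by (simp add: ell_smooth_def)
  with s obtain e L where e: "0 < e" "L-lipschitz_on (cball s e \<inter> {0..}) ell"
    unfolding locally_lipschitz_nonneg_def atLeast_iff by blast
  then have "continuous (at s within cball s e \<inter> {0..}) ell"
    using s lipschitz_on_continuous_on[OF e(2)] by (auto simp: continuous_on_eq_continuous_within)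
  moreover have "at s within cball s e \<inter> {0..} = at s within {0..}"
    by (rule at_within_nhd[of s "ball s e"]) (use e in auto)
  ultimately show "continuous (at s within {0..}) ell" by simp
qed

text \<open>Strict monotonicity makes the inverse well defined. The value \<open>v\<close> is
  attained because \<open>psi ell\<close> is continuous, vanishes at \<open>0\<close> and exceeds
  every bound.\<close>

lemma psi_inv_works:
  assumes psi_strict: "strict_mono_on {0..} (psi ell)"
    and psi_lim: "filterlim (psi ell) at_top at_top" and v: "0 < v"
  shows "0 < psi_inv ell v" and "psi ell (psi_inv ell v) = v"
proof -
  have psi0: "psi ell 0 = 0" by (simp add: psi_def)
  have "eventually (\<lambda>s. v \<le> psi ell s) at_top"
    using psi_lim by (simp add: filterlim_at_top)
  then have "eventually (\<lambda>s. v \<le> psi ell s \<and> 0 \<le> s) at_top"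
    using eventually_ge_at_top[of 0] by (rule eventually_conj)
  then obtain b where b: "v \<le> psi ell b" "0 \<le> b"
    using eventually_happens'[OF trivial_limit_at_top_linorder] by blast
  have "continuous_on {0..b} (\<lambda>s. ell (4 * s))"
    by (rule continuous_on_compose2[OF continuous_on_ell]) (auto intro!: continuous_intros)
  moreover have "2 * ell (4 * s) \<noteq> 0" if "s \<in> {0..b}" for s
    using ell_pos[of "4 * s"] that by auto
  ultimately have "continuous_on {0..b} (psi ell)"
    unfolding psi_def[abs_def] by (intro continuous_intros) auto
  then obtain s where s: "0 \<le> s" "psi ell s = v"
    using IVT'[of "psi ell" 0 v b] b v psi0 by auto
  have inj: "inj_on (psi ell) {0..}"
    using psi_strict by (rule strict_mono_on_imp_inj_on)
  have "psi_inv ell v = s"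
    unfolding psi_inv_def s(2)[symmetric] using s(1) by (intro the_inv_into_f_f inj) auto
  moreover have "s \<noteq> 0" using s v psi0 by auto
  ultimately show "0 < psi_inv ell v" "psi ell (psi_inv ell v) = v" using s by auto
qed

end

section \<open>Induction along the run\<close>

theorem theorem4p1:
  fixes f :: "real^'d \<Rightarrow> ereal" and ell :: "real \<Rightarrow> real"
    and x0 xstar :: "real^'d" and R Rbar \<Gamma>0 :: real
    and y u :: "nat \<Rightarrow> real^'d" and \<Gamma> \<gamma> \<alpha> :: "nat \<Rightarrow> real"
  assumes f_proper: "\<And>x. f x \<noteq> -\<infinity>"
    and dom_open: "open (dom_ext f)"
    and dom_convex: "convex (dom_ext f)"
    and dom_nonempty: "dom_ext f \<noteq> {}"
    and f_convex: "convex_ext f"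
    and f_smooth: "ell_smooth ell f"
    and xstar_min: "\<And>x. f xstar \<le> f x"
    and x0_dom: "x0 \<in> dom_ext f"
    and x0_neq: "x0 \<noteq> xstar"
    and R_eq: "R = norm (x0 - xstar)"
    and psi_strict: "strict_mono_on {0..} (psi ell)"
    and psi_lim: "filterlim (psi ell) at_top at_top"
    and \<Gamma>0_pos: "0 < \<Gamma>0"
    and \<Gamma>0_ge: "ereal \<Gamma>0 \<ge> 2 * (f x0 - f xstar) / ereal ((norm (x0 - xstar))\<^sup>2)"
    and Rbar_ge: "Rbar \<ge> R"
    and run: "accelerated_run f ell x0 \<Gamma>0 Rbar y u \<Gamma> \<gamma> \<alpha>"
  shows "\<forall>k. f (y (Suc k)) - f xstar \<le> ereal (\<Gamma> (Suc k) * R\<^sup>2)"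
proof -
  interpret convex_ell_smooth f ell
    by unfold_locales (fact f_proper dom_open dom_convex f_convex f_smooth)+
  have R: "0 < R" using x0_neq by (simp add: R_eq)
  have "f xstar < \<infinity>"
    using le_less_trans[OF xstar_min[of x0], of \<infinity>] x0_dom unfolding dom_ext_def by blast
  then have z: "xstar \<in> dom_ext f" by (simp add: dom_ext_def)
  have z_min: "F xstar \<le> F w" if "w \<in> dom_ext f" for w
    using xstar_min[of w] f_eq_F[OF z] f_eq_F[OF that] by (metis ereal_less_eq(3))
  have run_0: "y 0 = x0" "u 0 = x0" "\<Gamma> 0 = \<Gamma>0"
    and run_Suc: "\<gamma> k = 1 / ell (4 * psi_inv ell (\<Gamma> k * Rbar\<^sup>2))"
      "\<alpha> k = sqrt (\<gamma> k * \<Gamma> k)"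
      "y (Suc k) = accel_point (y k) (u k) (\<gamma> k) (\<alpha> k)"
      "u (Suc k) = closest_point (closure (dom_ext f)) (u k - (\<alpha> k / \<Gamma> k) *\<^sub>R grad f (y (Suc k)))"
      "\<Gamma> (Suc k) = \<Gamma> k / (1 + \<alpha> k)" for k
    using run unfolding accelerated_run_def accel_point_def by blast+
  \<comment> \<open>The potential is bounded with the true distance \<open>R\<close>;
    \<open>Rbar\<close> enters only through the step sizes.\<close>
  have inv: "y k \<in> dom_ext f \<and> u k \<in> closure (dom_ext f) \<and> 0 < \<Gamma> k \<and>
      F (y k) - F xstar + \<Gamma> k / 2 * (norm (u k - xstar))\<^sup>2 \<le> \<Gamma> k * R\<^sup>2" for k
  proof (induction k)
    case 0
    obtain a b where ab: "f x0 = ereal a" "f xstar = ereal b"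
      using f_eq_F x0_dom z by blast
    have "2 * (f x0 - f xstar) / ereal (R\<^sup>2) = ereal (2 * (a - b) / R\<^sup>2)"
      using R ab by simp
    then have "2 * (a - b) / R\<^sup>2 \<le> \<Gamma>0"
      using \<Gamma>0_ge unfolding R_eq[symmetric] by simp
    then have "2 * (a - b) \<le> \<Gamma>0 * R\<^sup>2"
      using R by (simp add: pos_divide_le_eq)
    then show ?case
      using x0_dom closure_subset[of "dom_ext f"] \<Gamma>0_pos ab
      by (auto simp: run_0 R_eq)
  next
    case (Suc k)
    define s where "s = psi_inv ell (\<Gamma> k * Rbar\<^sup>2)"
    have yk: "y k \<in> dom_ext f" and uk: "u k \<in> closure (dom_ext f)" and \<Gamma>k: "0 < \<Gamma> k"
      and V: "F (y k) - F xstar + \<Gamma> k / 2 * (norm (u k - xstar))\<^sup>2 \<le> \<Gamma> k * R\<^sup>2"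
      using Suc by auto
    have "0 < \<Gamma> k * Rbar\<^sup>2" using \<Gamma>k R Rbar_ge by simp
    from psi_inv_works[OF psi_strict psi_lim this]
    have s: "0 < s" "psi ell s = \<Gamma> k * Rbar\<^sup>2" by (simp_all add: s_def)
    have "\<Gamma> k * R\<^sup>2 \<le> \<Gamma> k * Rbar\<^sup>2"
      using \<Gamma>k R Rbar_ge by (intro mult_left_mono power_mono) auto
    with V have Vs: "F (y k) - F xstar + \<Gamma> k / 2 * (norm (u k - xstar))\<^sup>2 \<le> psi ell s"
      by (simp add: s(2))
    moreover have "0 \<le> \<Gamma> k / 2 * (norm (u k - xstar))\<^sup>2" using \<Gamma>k by simp
    ultimately have "psi ell (norm (grad f (y k))) \<le> psi ell s"
      using psi_grad_le[OF yk z_min] by linarith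
    then have gy: "norm (grad f (y k)) \<le> s"
      using strict_mono_onD[OF psi_strict, of s "norm (grad f (y k))"] s(1) by force
    have L: "0 < ell (4 * s)" using s by (simp add: ell_pos)
    have \<gamma>: "0 \<le> \<gamma> k" "\<gamma> k * ell (4 * s) \<le> 1"
      using L unfolding run_Suc(1)[of k] s_def[symmetric] by simp_all
    have \<alpha>: "0 \<le> \<alpha> k" using \<gamma> \<Gamma>k by (simp add: run_Suc(2))
    have y': "y (Suc k) \<in> dom_ext f"
      unfolding run_Suc(3) by (rule accel_point_in_dom[OF yk uk gy s(1) \<gamma> \<alpha>])
    have "norm (grad f (y (Suc k))) \<le> s"
      unfolding run_Suc(2,3)
      by (rule norm_grad_accel_point_le[OF yk uk z z_min psi_strict s(1) gy \<Gamma>k Vs \<gamma>])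
    then have "norm (grad f (y (Suc k))) < 2 * s" using s by simp
    from lyapunov_step[OF yk _ z gy _ s(1) \<gamma> \<Gamma>k, of "u k", folded run_Suc(2), folded run_Suc(3), OF y' this]
    have "(1 + \<alpha> k) * F (y (Suc k)) + \<Gamma> k / 2 * (norm (u (Suc k) - xstar))\<^sup>2 \<le>
        F (y k) + \<alpha> k * F xstar + \<Gamma> k / 2 * (norm (u k - xstar))\<^sup>2"
      by (simp only: run_Suc(4))
    also have "\<dots> \<le> (1 + \<alpha> k) * F xstar + \<Gamma> k * R\<^sup>2"
      using V by (simp add: algebra_simps)
    finally have "(1 + \<alpha> k) * F (y (Suc k)) + \<Gamma> k / 2 * (norm (u (Suc k) - xstar))\<^sup>2 \<le>
      (1 + \<alpha> k) * F xstar + \<Gamma> k * R\<^sup>2" .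
    \<comment> \<open>Every term now carries the factor \<open>1 + \<alpha> k\<close>, whose
      cancellation leaves the invariant for \<open>Suc k\<close>.\<close>
    moreover have "\<Gamma> k = (1 + \<alpha> k) * \<Gamma> (Suc k)"
      using \<alpha> by (simp add: run_Suc(5))
    ultimately have "(1 + \<alpha> k) * (F (y (Suc k)) - F xstar + \<Gamma> (Suc k) / 2 * (norm (u (Suc k) - xstar))\<^sup>2)
        \<le> (1 + \<alpha> k) * (\<Gamma> (Suc k) * R\<^sup>2)"
      by (simp add: algebra_simps)
    then have "F (y (Suc k)) - F xstar + \<Gamma> (Suc k) / 2 * (norm (u (Suc k) - xstar))\<^sup>2
        \<le> \<Gamma> (Suc k) * R\<^sup>2"
      by (rule mult_left_le_imp_le) (use \<alpha> in simp)
    moreover have "u (Suc k) \<in> closure (dom_ext f)"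
      unfolding run_Suc(4) using dom_nonempty by (intro closest_point_in_set) auto
    moreover have "0 < \<Gamma> (Suc k)" using \<Gamma>k \<alpha> by (simp add: run_Suc(5))
    ultimately show ?case using y' by blast
  qed
  show ?thesis
  proof
    fix k
    have "0 \<le> \<Gamma> (Suc k) / 2 * (norm (u (Suc k) - xstar))\<^sup>2"
      using inv[of "Suc k"] by simp
    then have "F (y (Suc k)) - F xstar \<le> \<Gamma> (Suc k) * R\<^sup>2"
      using inv[of "Suc k"] by linarith
    moreover obtain a b where "f (y (Suc k)) = ereal a" "f xstar = ereal b"
      using f_eq_F inv z by blast
    ultimately show "f (y (Suc k)) - f xstar \<le> ereal (\<Gamma> (Suc k) * R\<^sup>2)" by simp
  qed
qed

end
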